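(* Let $v$ be a flow on a connected compact surface $S$. The following are equivalent: (1) The orbit space $S/v$ is $T_1$. (2) The orbit space $S/v$ is $T_{1/2}$. (3) The flow $v$ is not minimal but Poisson stable.
   Context: A surface is a two-dimensional paracompact manifold, possibly with boundary. A flow is a continuous $\mathbb{R}$-action $v$ on $S$, $v_t=v(t,\cdot)$. The orbit space $S/v$ is the quotient of $S$ by orbits. A space is $T_1$ if every singleton is closed, and $T_{1/2}$ if every singleton is closed or open. The flow is minimal if $S$ has no nonempty proper closed invariant subsets. With $\omega(x)=\bigcap_{n\in\mathbb{R}}\overline{\{v_t(x)\mid t>n\}}$ and $\alpha(x)=\bigcap_{n\in\mathbb{R}}\overline{\{v_t(x)\mid t<n\}}$, a point is Poisson stable if $x\in\omega(x)\cap\alpha(x)$, and the flow is Poisson stable if every point is. *)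

theory Defs
  imports "HOL-Analysis.Analysis"
begin

definition half_plane :: "(real \<times> real) set" where
  "half_plane = {p. snd p \<ge> 0}"

text \<open>A surface: a Hausdorff space locally homeomorphic to open subsets of the
  closed half-plane (two-dimensional manifold, possibly with boundary).
  Paracompactness is automatic in the compact case considered here, but is
  included for fidelity.\<close>
definition paracompact_space :: "'a topology \<Rightarrow> bool" where
  "paracompact_space X \<longleftrightarrow>
     (\<forall>\<U>. (\<forall>U\<in>\<U>. openin X U) \<and> topspace X \<subseteq> \<Union>\<U> \<longrightarrow>
        (\<exists>\<V>. (\<forall>V\<in>\<V>. openin X V \<and> (\<exists>U\<in>\<U>. V \<subseteq> U)) \<and> topspace X \<subseteq> \<Union>\<V> \<and>
             (\<forall>x\<in>topspace X. \<exists>N. openin X N \<and> x \<in> N \<and>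
                 finite {V\<in>\<V>. V \<inter> N \<noteq> {}})))"

definition surface :: "'a topology \<Rightarrow> bool" where
  "surface X \<longleftrightarrow> Hausdorff_space X \<and> paracompact_space X \<and>
     (\<forall>x\<in>topspace X. \<exists>U W. openin X U \<and> x \<in> U \<and>
        openin (subtopology euclidean half_plane) W \<and>
        subtopology X U homeomorphic_space subtopology euclidean W)"

definition flow :: "'a topology \<Rightarrow> (real \<Rightarrow> 'a \<Rightarrow> 'a) \<Rightarrow> bool" where
  "flow X v \<longleftrightarrow>
     continuous_map (prod_topology euclideanreal X) X (\<lambda>(t, x). v t x) \<and>
     (\<forall>x\<in>topspace X. v 0 x = x) \<and>
     (\<forall>s t. \<forall>x\<in>topspace X. v (s + t) x = v s (v t x))"

definition orbit :: "(real \<Rightarrow> 'a \<Rightarrow> 'a) \<Rightarrow> 'a \<Rightarrow> 'a set" where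
  "orbit v x = range (\<lambda>t. v t x)"

definition quotient_topology :: "'a topology \<Rightarrow> ('a \<Rightarrow> 'b) \<Rightarrow> 'b topology" where
  "quotient_topology X q =
     topology (\<lambda>U. U \<subseteq> q ` topspace X \<and> openin X {x \<in> topspace X. q x \<in> U})"

lemma istopology_quotient:
  "istopology (\<lambda>U. U \<subseteq> q ` topspace X \<and> openin X {x \<in> topspace X. q x \<in> U})"
proof -
  have i: "{x \<in> topspace X. q x \<in> S \<inter> T} =
           {x \<in> topspace X. q x \<in> S} \<inter> {x \<in> topspace X. q x \<in> T}" for S T by auto
  have u: "{x \<in> topspace X. q x \<in> \<Union>K} = \<Union>((\<lambda>U. {x \<in> topspace X. q x \<in> U}) ` K)"
    for K by auto
  have A: "\<And>S T. openin X {x \<in> topspace X. q x \<in> S} \<Longrightarrow> openin X {x \<in> topspace X. q x \<in> T}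
     \<Longrightarrow> openin X {x \<in> topspace X. q x \<in> S \<inter> T}"
    unfolding i by auto
  have B: "\<And>K. \<forall>U\<in>K. openin X {x \<in> topspace X. q x \<in> U}
     \<Longrightarrow> openin X {x \<in> topspace X. q x \<in> \<Union>K}"
    unfolding u by (auto intro!: openin_Union)
  show ?thesis
    unfolding istopology_def using A B by blast
qed

lemma openin_quotient_topology:
  "openin (quotient_topology X q) U \<longleftrightarrow>
     U \<subseteq> q ` topspace X \<and> openin X {x \<in> topspace X. q x \<in> U}"
  unfolding quotient_topology_def by (simp add: istopology_quotient)

definition orbit_space :: "'a topology \<Rightarrow> (real \<Rightarrow> 'a \<Rightarrow> 'a) \<Rightarrow> 'a set topology" where
  "orbit_space X v = quotient_topology X (orbit v)"

definition t_half_space :: "'a topology \<Rightarrow> bool" where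
  "t_half_space X \<longleftrightarrow> (\<forall>x\<in>topspace X. closedin X {x} \<or> openin X {x})"

definition minimal_flow :: "'a topology \<Rightarrow> (real \<Rightarrow> 'a \<Rightarrow> 'a) \<Rightarrow> bool" where
  "minimal_flow X v \<longleftrightarrow>
     \<not> (\<exists>A. closedin X A \<and> A \<noteq> {} \<and> A \<noteq> topspace X \<and> (\<forall>t. \<forall>x\<in>A. v t x \<in> A))"

definition omega_limit :: "'a topology \<Rightarrow> (real \<Rightarrow> 'a \<Rightarrow> 'a) \<Rightarrow> 'a \<Rightarrow> 'a set" where
  "omega_limit X v x = (\<Inter>n::real. X closure_of {v t x | t. t > n})"

definition alpha_limit :: "'a topology \<Rightarrow> (real \<Rightarrow> 'a \<Rightarrow> 'a) \<Rightarrow> 'a \<Rightarrow> 'a set" where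
  "alpha_limit X v x = (\<Inter>n::real. X closure_of {v t x | t. t < n})"

definition poisson_stable_flow :: "'a topology \<Rightarrow> (real \<Rightarrow> 'a \<Rightarrow> 'a) \<Rightarrow> bool" where
  "poisson_stable_flow X v \<longleftrightarrow>
     (\<forall>x\<in>topspace X. x \<in> omega_limit X v x \<inter> alpha_limit X v x)"

end

theory Submission
  imports Defs
begin

text \<open>No orbit is open, because a local cross-section is uncountable while an orbit meets it in a
  countable set; so \<open>T\<^sub>1\<close> and \<open>T\<^sub>1\<^sub>/\<^sub>2\<close> both say that all orbits are closed. A closed orbit in a compact
  space contains its limit sets, hence lies in them.

  Conversely let the flow be Poisson stable with a non-periodic point x. The orbit of x returns to a
  small cross-section at x at least three times, and some arc in the section joins two of these
  points through the third. The set swept by the open arc is open by invariance of domain, and the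
  endpoints of the arc flow into it. Recurrence and compactness bound the return times to the closed
  arc, so the saturation of the arc is also compact, hence everything: every orbit passes near x.
  Thus x lies in every orbit closure, so no point is periodic, and the same argument at every point
  shows that the flow is minimal.\<close>

section \<open>Level functions and arcs\<close>

text \<open>The derivative with respect to \<open>t\<close> of the integral of \<open>g\<close> over
  the window from \<open>t\<close> to \<open>t + \<tau>\<close> is
  \<open>g (t + \<tau>) - g t\<close>, which the hypothesis makes positive between \<open>a\<close>
  and \<open>b\<close>.\<close>

lemma moving_integral_strict_mono:
  fixes g :: "real \<Rightarrow> real"
  assumes g: "continuous_on UNIV g" and "0 \<le> \<tau>" "a < b"
    and less: "\<And>s. \<lbrakk>a \<le> s; s \<le> b\<rbrakk> \<Longrightarrow> g s < g (s + \<tau>)"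
  shows "integral {0..\<tau>} (\<lambda>s. g (s + a)) < integral {0..\<tau>} (\<lambda>s. g (s + b))"
proof -
  \<comment> \<open>The margin of 1 on both sides puts every time that occurs into the interior of
    the interval, where the derivative of the primitive is two-sided.\<close>
  define l r where "l = a - 1" and "r = b + \<tau> + 1"
  define G where "G t = integral {l..t} g" for t
  have "(G has_real_derivative g t) (at t within {l..r})" if "t \<in> {l..r}" for t
    unfolding G_def
    using g that by (intro integral_has_real_derivative) (auto intro: continuous_on_subset)
  then have G: "(G has_real_derivative g t) (at t)" if "l < t" "t < r" for t
    using that by (metis at_within_Icc_at atLeastAtMost_iff less_eq_real_def)
  have shift: "integral {0..\<tau>} (\<lambda>s. g (s + t)) = G (t + \<tau>) - G t" if "a \<le> t" "t \<le> b" for t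
  proof -
    have "((\<lambda>s. g (s + t)) has_integral (G (\<tau> + t) - G (0 + t))) {0..\<tau>}"
    proof (rule fundamental_theorem_of_calculus)
      fix s assume "s \<in> {0..\<tau>}"
      then have "l < s + t" "s + t < r"
        using that by (auto simp: l_def r_def)
      then have "((\<lambda>s. G (s + t)) has_real_derivative g (s + t)) (at s)"
        using G[of "s + t"] by (simp add: DERIV_shift add.commute)
      then show "((\<lambda>s. G (s + t)) has_vector_derivative g (s + t)) (at s within {0..\<tau>})"
        by (simp add: has_real_derivative_iff_has_vector_derivative has_vector_derivative_at_within)
    qed (use assms in auto)
    then show ?thesis
      by (simp add: integral_unique add.commute)
  qed
  have "G (a + \<tau>) - G a < G (b + \<tau>) - G b"
  proof (rule DERIV_pos_imp_increasing[OF \<open>a < b\<close>])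
    fix t assume t: "a \<le> t" "t \<le> b"
    have "((\<lambda>t. G (t + \<tau>) - G t) has_real_derivative g (t + \<tau>) - g t) (at t)"
    proof (rule DERIV_diff)
      show "((\<lambda>t. G (t + \<tau>)) has_real_derivative g (t + \<tau>)) (at t)"
        using G[of "t + \<tau>"] t \<open>0 \<le> \<tau>\<close> by (simp add: DERIV_shift l_def r_def)
      show "(G has_real_derivative g t) (at t)"
        using G[of t] t \<open>0 \<le> \<tau>\<close> by (simp add: l_def r_def)
    qed
    then show "\<exists>y. ((\<lambda>t. G (t + \<tau>) - G t) has_real_derivative y) (at t) \<and> 0 < y"
      using less[OF t] by force
  qed
  then show ?thesis
    using \<open>a < b\<close> by (simp add: shift)
qed

text \<open>An implicit function theorem in which strict monotonicity replaces differentiability.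
  The intermediate value theorem gives a crossing time. The strict inequalities just before and just
  after it persist for nearby \<open>w\<close> and trap the crossing times there, hence
  continuity.\<close>

lemma strict_mono_level_function:
  fixes h :: "'b::topological_space \<Rightarrow> real \<Rightarrow> real"
  assumes h: "continuous_on (B \<times> UNIV) (\<lambda>(w, t). h w t)"
    and mono: "\<And>w a b. \<lbrakk>w \<in> B; -\<eta> \<le> a; a < b; b \<le> \<eta>\<rbrakk> \<Longrightarrow> h w a < h w b"
    and bd: "\<And>w. w \<in> B \<Longrightarrow> h w (-\<eta>) < c \<and> c < h w \<eta>" and "0 < \<eta>"
  obtains \<tau> where "continuous_on B \<tau>" "\<And>w. w \<in> B \<Longrightarrow> \<bar>\<tau> w\<bar> < \<eta> \<and> h w (\<tau> w) = c"
proof -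
  have "\<exists>t. \<bar>t\<bar> < \<eta> \<and> h w t = c" if w: "w \<in> B" for w
  proof -
    have "continuous_on UNIV (\<lambda>t. (\<lambda>(w, t). h w t) (w, t))"
      by (rule continuous_on_compose2[OF h]) (use w in \<open>auto intro!: continuous_intros\<close>)
    then have "continuous_on {-\<eta>..\<eta>} (h w)"
      by (auto intro: continuous_on_subset)
    then obtain t where "-\<eta> \<le> t" "t \<le> \<eta>" "h w t = c"
      using IVT'[of "h w" "-\<eta>" c \<eta>] bd[OF w] \<open>0 < \<eta>\<close> by force
    moreover have "t \<noteq> -\<eta>" "t \<noteq> \<eta>"
      using bd[OF w] \<open>h w t = c\<close> by auto
    ultimately show ?thesis
      by (intro exI[of _ t]) auto
  qed
  then obtain \<tau> where \<tau>: "\<And>w. w \<in> B \<Longrightarrow> \<bar>\<tau> w\<bar> < \<eta> \<and> h w (\<tau> w) = c"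
    by metis
  have slice: "((\<lambda>w. h w a) \<longlongrightarrow> h w a) (at w within B)" if "w \<in> B" for w a
  proof -
    have "continuous_on B (\<lambda>w. (\<lambda>(w, t). h w t) (w, a))"
      by (rule continuous_on_compose2[OF h]) (auto intro!: continuous_intros)
    then show ?thesis
      using that by (simp add: continuous_on_def)
  qed
  have "continuous_on B \<tau>"
    unfolding continuous_on_def
  proof (intro ballI order_tendstoI)
    fix w a assume w: "w \<in> B" and a: "a < \<tau> w"
    \<comment> \<open>Clamping at \<open>-\<eta>\<close> keeps the comparison inside the window on
      which \<open>h\<close> is monotone.\<close>
    define a' where "a' = max a (-\<eta>)"
    have a': "-\<eta> \<le> a'" "a' < \<tau> w" "a \<le> a'"
      using a \<tau>[OF w] by (auto simp: a'_def)
    have "h w a' < c"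
      using mono[OF w a'(1,2)] \<tau>[OF w] by auto
    then have "\<forall>\<^sub>F u in at w within B. h u a' < c"
      using slice[OF w] by (rule order_tendstoD(2)[rotated])
    moreover have "\<forall>\<^sub>F u in at w within B. u \<in> B"
      by (simp add: eventually_at_filter)
    ultimately show "\<forall>\<^sub>F u in at w within B. a < \<tau> u"
    proof eventually_elim
      case (elim u)
      have "\<not> \<tau> u < a'"
        using mono[of u "\<tau> u" a'] \<tau>[of u] \<tau>[OF w] a' elim by (auto simp: abs_less_iff)
      moreover have "\<tau> u \<noteq> a'"
        using \<tau>[of u] elim by auto
      ultimately show ?case
        using a' by auto
    qed
  next
    fix w a assume w: "w \<in> B" and a: "\<tau> w < a"
    define a' where "a' = min a \<eta>"
    have a': "a' \<le> \<eta>" "\<tau> w < a'" "a' \<le> a"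
      using a \<tau>[OF w] by (auto simp: a'_def)
    have "c < h w a'"
      using mono[OF w _ a'(2,1)] \<tau>[OF w] by auto
    then have "\<forall>\<^sub>F u in at w within B. c < h u a'"
      using slice[OF w] by (rule order_tendstoD(1)[rotated])
    moreover have "\<forall>\<^sub>F u in at w within B. u \<in> B"
      by (simp add: eventually_at_filter)
    ultimately show "\<forall>\<^sub>F u in at w within B. \<tau> u < a"
    proof eventually_elim
      case (elim u)
      have "\<not> a' < \<tau> u"
        using mono[of u a' "\<tau> u"] \<tau>[of u] \<tau>[OF w] a' elim by (auto simp: abs_less_iff)
      moreover have "\<tau> u \<noteq> a'"
        using \<tau>[of u] elim by auto
      ultimately show ?case
        using a' by auto
    qed
  qed
  then show ?thesis
    using \<tau> that by blast
qed

text \<open>The hypothesis \<open>ope\<close> forbids branching: a path in \<open>Q\<close> can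
  enter an arc only through an endpoint. So if an arc from \<open>a\<close> to \<open>b\<close>
  misses \<open>c\<close>, a path from \<open>c\<close> first meets it at \<open>a\<close> or
  \<open>b\<close>, and prolonging the arc by this path makes that endpoint an interior
  point.\<close>

lemma arc_through_third_point:
  fixes Q :: "'a::euclidean_space set"
  assumes Q: "path_connected Q"
    and ope: "\<And>g. \<lbrakk>arc g; path_image g \<subseteq> Q\<rbrakk> \<Longrightarrow> openin (top_of_set Q) (g ` {0<..<1})"
    and A: "a \<in> Q" "b \<in> Q" "c \<in> Q" "a \<noteq> b" "a \<noteq> c" "b \<noteq> c"
  obtains g where "arc g" "path_image g \<subseteq> Q" "pathstart g \<in> {a, b, c}" "pathfinish g \<in> {a, b, c}"
    "g ` {0<..<1} \<inter> {a, b, c} \<noteq> {}"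
proof -
  obtain g where g: "arc g" "path_image g \<subseteq> Q" "pathstart g = a" "pathfinish g = b"
    using Q A unfolding path_connected_arcwise by metis
  have g_eq: "path_image g = g ` {0<..<1} \<union> {a, b}"
  proof -
    have "{0..1::real} = {0<..<1} \<union> {0, 1}"
      by auto
    then show ?thesis
      using g unfolding path_image_def pathstart_def pathfinish_def by auto
  qed
  show thesis
  proof (cases "c \<in> path_image g")
    case True
    then show thesis
      using that[of g] g A g_eq by auto
  next
    case False
    obtain h where h: "arc h" "path_image h \<subseteq> Q" "pathstart h = c" "pathfinish h = a"
      using Q A unfolding path_connected_arcwise by metis
    have ch: "continuous_on {0..1} h"
      using h arc_imp_path path_def by blast
    define K where "K = {0..1} \<inter> h -` path_image g"
    have "closed (path_image g)"
      using g by (simp add: arc_imp_path closed_path_image)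
    then have "compact K"
      unfolding K_def compact_eq_bounded_closed
      by (intro conjI continuous_closed_preimage ch) (auto intro: bounded_subset[of "{0..1}"])
    moreover have "1 \<in> K"
      using h g pathstart_in_path_image[of g] by (auto simp: K_def pathfinish_def)
    \<comment> \<open>Compactness of \<open>K\<close> gives the first parameter at which the path
      from \<open>c\<close> meets the arc.\<close>
    ultimately obtain u where u: "u \<in> K" "\<And>k. k \<in> K \<Longrightarrow> u \<le> k"
      using compact_attains_inf[of K] by blast
    have "u \<noteq> 0"
      using u False h by (auto simp: K_def pathstart_def)
    then have u01: "0 < u" "u \<le> 1"
      using u by (auto simp: K_def)
    \<comment> \<open>If the first hit were in the interior of the arc, openness of this interior in
      \<open>Q\<close> would give slightly earlier hits.\<close>
    have "h u \<notin> g ` {0<..<1}"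
    proof
      assume hu: "h u \<in> g ` {0<..<1}"
      have "continuous_on {0..1} h" "h \<in> {0..1} \<rightarrow> Q"
        using ch h by (auto simp: path_image_def)
      then have "openin (top_of_set {0..1}) ({0..1} \<inter> h -` (g ` {0<..<1}))"
        using ope[OF g(1,2)] continuous_openin_preimage by blast
      then obtain e where e: "e > 0"
        "\<And>k. k \<in> {0..1} \<Longrightarrow> dist k u < e \<Longrightarrow> h k \<in> g ` {0<..<1}"
        using hu u01 unfolding openin_euclidean_subtopology_iff
        by (metis (no_types, lifting) IntI atLeastAtMost_iff less_imp_le vimageE vimageI2 Int_iff)
      define k where "k = max 0 (u - e / 2)"
      have "h k \<in> g ` {0<..<1}"
        using e(1) u01 by (intro e(2)) (auto simp: k_def dist_real_def)
      then have "k \<in> K"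
        using u01 e(1) by (auto simp: K_def k_def g_eq)
      then show False
        using u(2)[of k] u01 e(1) by (auto simp: k_def)
    qed
    then have hu: "h u \<in> {a, b}"
      using u g_eq by (auto simp: K_def)
    define k where "k = subpath 0 u h"
    have k: "arc k" "path_image k \<subseteq> Q" "pathstart k = c" "pathfinish k = h u"
      using u01 h path_image_subpath_subset[of 0 u h] unfolding k_def pathstart_subpath pathfinish_subpath
      by (auto intro!: arc_subpath_arc simp: pathstart_def)
    have kg: "path_image k \<inter> path_image g \<subseteq> {h u}"
    proof
      fix y assume y: "y \<in> path_image k \<inter> path_image g"
      then obtain s where s: "0 \<le> s" "s \<le> u" "y = h s"
        using u01 by (auto simp: k_def path_image_subpath)
      then have "s \<in> K"
        using y u01 by (auto simp: K_def)
      then show "y \<in> {h u}"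
        using u(2)[of s] s by auto
    qed
    \<comment> \<open>The arc is reoriented so that it starts where the path from \<open>c\<close>
      arrives.\<close>
    obtain g' where g': "arc g'" "path_image g' = path_image g" "pathstart g' = h u"
      "pathfinish g' \<in> {a, b}"
    proof (cases "h u = a")
      case True
      then show ?thesis
        using g that[of g] by auto
    next
      case False
      then show ?thesis
        using g hu that[of "reversepath g"] by (auto simp: arc_reversepath)
    qed
    have "arc (k +++ g')"
      using k g' kg by (intro arc_join) auto
    \<comment> \<open>The joint is the required interior point: it is \<open>a\<close> or
      \<open>b\<close>, while the joined arc runs from \<open>c\<close> to the other one.\<close>
    moreover have "(k +++ g') (1/2) = h u"
      using k by (simp add: joinpaths_def pathfinish_def)
    then have "h u \<in> (k +++ g') ` {0<..<1}"
      by (intro image_eqI[of _ _ "1/2"]) auto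
    moreover have "path_image (k +++ g') \<subseteq> Q"
      using k g' g by (simp add: path_image_join)
    ultimately show thesis
      using that[of "k +++ g'"] k g' hu by auto
  qed
qed

text \<open>In a chart an isolated point would be isolated in the half-plane, but every point of the
  half-plane, even on its boundary, can be moved upwards by a small amount.\<close>

lemma surface_not_openin_singleton:
  assumes "surface X"
  shows "\<not> openin X {x}"
proof
  assume ope: "openin X {x}"
  then have "x \<in> topspace X"
    using openin_subset by blast
  then obtain U W \<phi> \<psi> where U: "x \<in> U" and W: "openin (top_of_set half_plane) W"
    and hom: "homeomorphic_maps (subtopology X U) (top_of_set W) \<phi> \<psi>"
    using \<open>surface X\<close> unfolding surface_def homeomorphic_space_def by metis
  have "continuous_map (top_of_set W) X \<psi>" and inv: "\<And>w. w \<in> W \<Longrightarrow> \<phi> (\<psi> w) = w"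
    and \<phi>x: "\<phi> x \<in> W" "\<psi> (\<phi> x) = x"
    using hom U \<open>x \<in> topspace X\<close>
    by (auto simp: homeomorphic_maps_def continuous_map_in_subtopology)
  then have "openin (top_of_set W) {w \<in> topspace (top_of_set W). \<psi> w \<in> {x}}"
    using ope openin_continuous_map_preimage by blast
  also have "{w \<in> topspace (top_of_set W). \<psi> w \<in> {x}} = {\<phi> x}"
    using \<phi>x inv by auto
  finally have "openin (top_of_set half_plane) {\<phi> x}"
    using W openin_trans by blast
  then obtain e where e: "e > 0" "\<And>w. \<lbrakk>w \<in> half_plane; dist w (\<phi> x) < e\<rbrakk> \<Longrightarrow> w = \<phi> x"
    and "\<phi> x \<in> half_plane"
    unfolding openin_euclidean_subtopology_iff by auto
  then have "\<phi> x + (0, e / 2) = \<phi> x"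
    by (intro e(2)) (auto simp: half_plane_def dist_norm norm_Pair)
  then show False
    using e(1) by (auto simp: prod_eq_iff)
qed

section \<open>Local cross-sections\<close>

locale flow_on =
  fixes X :: "'a topology" and v :: "real \<Rightarrow> 'a \<Rightarrow> 'a"
  assumes flow: "flow X v"
begin

lemma flow_zero: "x \<in> topspace X \<Longrightarrow> v 0 x = x"
  using flow by (simp add: flow_def)

lemma flow_add: "x \<in> topspace X \<Longrightarrow> v s (v t x) = v (s + t) x"
  using flow by (simp add: flow_def)

lemma continuous_map_flow_comp:
  assumes "continuous_map Z euclideanreal T" "continuous_map Z X p"
  shows "continuous_map Z X (\<lambda>z. v (T z) (p z))"
proof -
  have "continuous_map Z (prod_topology euclideanreal X) (\<lambda>z. (T z, p z))"
    using assms by (intro continuous_map_pairedI)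
  moreover have "continuous_map (prod_topology euclideanreal X) X (\<lambda>(t, x). v t x)"
    using flow by (simp add: flow_def)
  ultimately have "continuous_map Z X ((\<lambda>(t, x). v t x) \<circ> (\<lambda>z. (T z, p z)))"
    by (rule continuous_map_compose)
  then show ?thesis
    by (simp add: o_def)
qed

lemma continuous_map_flow: "continuous_map X X (v t)"
  using continuous_map_flow_comp[of X "\<lambda>_. t" "\<lambda>x. x"] by simp

lemma flow_in_topspace: "x \<in> topspace X \<Longrightarrow> v t x \<in> topspace X"
  using continuous_map_flow[of t] by (auto simp: continuous_map_def)

lemma continuous_map_time: "x \<in> topspace X \<Longrightarrow> continuous_map euclideanreal X (\<lambda>t. v t x)"
  using continuous_map_flow_comp[of euclideanreal "\<lambda>t. t" "\<lambda>_. x"] by simp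

lemma flow_inverse: "x \<in> topspace X \<Longrightarrow> v (-t) (v t x) = x"
  by (simp add: flow_add flow_zero)

lemma flow_inject: "\<lbrakk>x \<in> topspace X; y \<in> topspace X; v t x = v t y\<rbrakk> \<Longrightarrow> x = y"
  by (metis flow_inverse)

text \<open>The parameter set \<open>Q\<close> is planar because paths and arcs live in a type,
  whereas the surface is an abstract topology. The bound \<open>2 * \<eta>\<close> is what makes the
  sets swept for times below \<open>\<eta>\<close> injectively parametrised, since two such times
  differ by less than \<open>2 * \<eta>\<close>. Openness is asked only along arcs, as
  \<open>Q\<close> itself need not be an arc.\<close>

definition cross_section :: "real \<Rightarrow> (real \<times> real) set \<Rightarrow> (real \<times> real \<Rightarrow> 'a) \<Rightarrow> bool" where
  "cross_section \<eta> Q \<sigma> \<longleftrightarrow> \<eta> > 0 \<and> path_connected Q \<and> uncountable Q \<and>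
     continuous_map (top_of_set Q) X \<sigma> \<and>
     (\<forall>p\<in>Q. \<forall>q\<in>Q. \<forall>s. \<bar>s\<bar> < 2 * \<eta> \<and> v s (\<sigma> p) = \<sigma> q \<longrightarrow> s = 0 \<and> p = q) \<and>
     (\<forall>g. arc g \<and> path_image g \<subseteq> Q \<longrightarrow>
        openin X {v s (\<sigma> (g u)) |s u. \<bar>s\<bar> < \<eta> \<and> 0 < u \<and> u < 1})"

lemma cross_sectionD:
  assumes "cross_section \<eta> Q \<sigma>"
  shows "\<eta> > 0" "path_connected Q" "uncountable Q" "continuous_map (top_of_set Q) X \<sigma>"
    "\<And>p q s. \<lbrakk>p \<in> Q; q \<in> Q; \<bar>s\<bar> < 2 * \<eta>; v s (\<sigma> p) = \<sigma> q\<rbrakk> \<Longrightarrow> s = 0 \<and> p = q"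
    "\<And>g. \<lbrakk>arc g; path_image g \<subseteq> Q\<rbrakk> \<Longrightarrow>
        openin X {v s (\<sigma> (g u)) |s u. \<bar>s\<bar> < \<eta> \<and> 0 < u \<and> u < 1}"
  using assms unfolding cross_section_def by blast+

text \<open>The section is a level set of the moving average of f along orbits: by the choice of f this
  average is strictly increasing along orbits near x. On an arc inside the section the flow is
  injective for short times, so invariance of domain makes the swept set open; this is also valid
  at boundary points of the surface, as the swept set is then open in the whole plane.\<close>
lemma local_section:
  assumes "surface X" "compact_space X" and x: "x \<in> topspace X" and moved: "v \<tau> x \<noteq> x"
    and N: "openin X N" "x \<in> N"
  obtains \<eta> Q \<sigma> M where "cross_section \<eta> Q \<sigma>" "\<sigma> ` Q \<subseteq> N" "openin X M" "x \<in> M"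
    "\<And>y. y \<in> M \<Longrightarrow> \<exists>s. \<bar>s\<bar> < \<eta> \<and> v s y \<in> \<sigma> ` Q"
proof -
  obtain \<tau>' where \<tau>': "\<tau>' > 0" "v \<tau>' x \<noteq> x"
  proof (cases "\<tau> > 0")
    case True
    then show ?thesis using moved that by blast
  next
    case False
    have "\<tau> \<noteq> 0"
      using moved flow_zero[OF x] by auto
    moreover have "v (-\<tau>) x \<noteq> x"
      using moved flow_inverse[OF x, of "-\<tau>"] by auto
    ultimately show ?thesis
      using False that[of "-\<tau>"] by auto
  qed
  have haus: "Hausdorff_space X"
    using assms by (simp add: surface_def)
  \<comment> \<open>The difference between the values of \<open>f\<close> at
    \<open>v \<tau>' x\<close> and at \<open>x\<close> is the derivative at time 0 of the moving
    average along the orbit of \<open>x\<close>; Urysohn's lemma makes it positive.\<close>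
  obtain f where f: "continuous_map X euclideanreal f" "f x = 0" "f (v \<tau>' x) = 1"
  proof -
    have "normal_space X"
      using haus \<open>compact_space X\<close> compact_Hausdorff_or_regular_imp_normal_space by blast
    moreover have "closedin X {x}" "closedin X {v \<tau>' x}"
      using haus x flow_in_topspace by (simp_all add: closedin_Hausdorff_singleton)
    moreover have "disjnt {x} {v \<tau>' x}"
      using \<tau>' by (auto simp: disjnt_def)
    ultimately obtain f where "continuous_map X euclideanreal f" "f ` {x} \<subseteq> {0}" "f ` {v \<tau>' x} \<subseteq> {1}"
      using Urysohn_lemma_alt[of X "{x}" "{v \<tau>' x}" 0 1] by blast
    then show ?thesis
      using that by auto
  qed
  obtain U W \<phi> \<psi> where U: "openin X U" "x \<in> U" and W: "openin (top_of_set half_plane) W"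
    and hom: "homeomorphic_maps (subtopology X U) (top_of_set W) \<phi> \<psi>"
    using \<open>surface X\<close> x unfolding surface_def homeomorphic_space_def by metis
  have US: "U \<subseteq> topspace X"
    using U openin_subset by blast
  then have topU: "topspace (subtopology X U) = U"
    by auto
  have c\<phi>: "continuous_map (subtopology X U) (top_of_set W) \<phi>"
    and c\<psi>': "continuous_map (top_of_set W) (subtopology X U) \<psi>"
    and \<psi>\<phi>: "\<And>y. y \<in> U \<Longrightarrow> \<psi> (\<phi> y) = y" and \<phi>\<psi>: "\<And>w. w \<in> W \<Longrightarrow> \<phi> (\<psi> w) = w"
    using hom topU by (auto simp: homeomorphic_maps_def)
  have c\<psi>: "continuous_map (top_of_set W) X \<psi>" and \<psi>U: "\<And>w. w \<in> W \<Longrightarrow> \<psi> w \<in> U"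
    using c\<psi>' by (auto simp: continuous_map_in_subtopology)
  have \<phi>W: "\<And>y. y \<in> U \<Longrightarrow> \<phi> y \<in> W"
    using c\<phi> topU by (auto simp: continuous_map_in_subtopology)
  have \<psi>S: "\<And>w. w \<in> W \<Longrightarrow> \<psi> w \<in> topspace X"
    using \<psi>U US by blast
  have WH: "W \<subseteq> half_plane"
    using W openin_imp_subset by blast
  define w0 where "w0 = \<phi> x"
  have w0: "w0 \<in> W" "\<psi> w0 = x"
    using U \<phi>W \<psi>\<phi> by (auto simp: w0_def)
  have cE: "continuous_map (top_of_set (W \<times> UNIV)) X (\<lambda>z. v (snd z + k) (\<psi> (fst z)))" for k
  proof (rule continuous_map_flow_comp)
    show "continuous_map (top_of_set (W \<times> UNIV)) euclideanreal (\<lambda>z. snd z + k)"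
      by (auto intro!: continuous_intros)
    have "continuous_map (top_of_set (W \<times> (UNIV::real set))) (top_of_set W) fst"
      by (auto simp: continuous_map_in_subtopology intro!: continuous_intros)
    then have "continuous_map (top_of_set (W \<times> (UNIV::real set))) X (\<psi> \<circ> fst)"
      using c\<psi> by (rule continuous_map_compose)
    then show "continuous_map (top_of_set (W \<times> (UNIV::real set))) X (\<lambda>z. \<psi> (fst z))"
      by (simp add: o_def)
  qed
  define F where "F y = integral {0..\<tau>'} (\<lambda>s. f (v s y))" for y
  have F_cont: "continuous_on (W \<times> UNIV) (\<lambda>(w, t). F (v t (\<psi> w)))"
  proof -
    define k where "k z s = f (v (s + snd z) (\<psi> (fst z)))" for z :: "(real \<times> real) \<times> real" and s
    let ?Z = "top_of_set ((W \<times> (UNIV::real set)) \<times> cbox 0 \<tau>')"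
    have "continuous_map ?Z X (\<lambda>y. v (snd y + snd (fst y)) (\<psi> (fst (fst y))))"
    proof (rule continuous_map_flow_comp)
      show "continuous_map ?Z euclideanreal (\<lambda>y. snd y + snd (fst y))"
        by (auto intro!: continuous_intros)
      have "continuous_map ?Z (top_of_set W) (\<lambda>y. fst (fst y))"
        by (auto simp: continuous_map_in_subtopology intro!: continuous_intros)
      then have "continuous_map ?Z X (\<psi> \<circ> (\<lambda>y. fst (fst y)))"
        using c\<psi> by (rule continuous_map_compose)
      then show "continuous_map ?Z X (\<lambda>y. \<psi> (fst (fst y)))"
        by (simp add: o_def)
    qed
    from continuous_map_compose[OF this f(1)]
    have "continuous_on ((W \<times> UNIV) \<times> cbox 0 \<tau>') (\<lambda>(z, s). k z s)"
      by (simp add: o_def k_def case_prod_beta)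
    then have "continuous_on (W \<times> UNIV) (\<lambda>z. integral (cbox 0 \<tau>') (k z))"
      by (rule integral_continuous_on_param)
    then show ?thesis
      by (rule continuous_on_eq) (auto simp: k_def[abs_def] F_def flow_add \<psi>S)
  qed
  \<comment> \<open>These conditions are open and hold at \<open>(w0, 0)\<close>: the moved point
    lies in the chart and in \<open>N\<close>, and the moving average has positive derivative
    there.\<close>
  define A where "A = {z \<in> W \<times> UNIV. v (snd z) (\<psi> (fst z)) \<in> U \<inter> N \<and>
      f (v (snd z) (\<psi> (fst z))) < f (v (snd z + \<tau>') (\<psi> (fst z)))}"
  obtain \<rho> where \<rho>: "\<rho> > 0" "\<And>w t. \<lbrakk>w \<in> W; dist w w0 + \<bar>t\<bar> < \<rho>\<rbrakk> \<Longrightarrow> (w, t) \<in> A"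
  proof -
    let ?Z = "top_of_set (W \<times> (UNIV::real set))"
    have cf: "continuous_map ?Z euclideanreal (\<lambda>z. f (v (snd z + k) (\<psi> (fst z))))" for k
      using continuous_map_compose[OF cE f(1), of k] by (simp add: o_def)
    have "openin ?Z {z \<in> topspace ?Z. v (snd z + 0) (\<psi> (fst z)) \<in> U \<inter> N}"
      using openin_continuous_map_preimage[OF cE[of 0] openin_Int[OF U(1) N(1)]] .
    moreover have "openin ?Z {z \<in> topspace ?Z. f (v (snd z + \<tau>') (\<psi> (fst z)))
        - f (v (snd z + 0) (\<psi> (fst z))) \<in> {0<..}}"
      by (rule openin_continuous_map_preimage[where Y = euclideanreal])
        (use cf[of \<tau>'] cf[of 0] in \<open>auto intro!: continuous_intros\<close>)
    ultimately have "openin ?Z ({z \<in> topspace ?Z. v (snd z + 0) (\<psi> (fst z)) \<in> U \<inter> N} \<inter>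
      {z \<in> topspace ?Z. f (v (snd z + \<tau>') (\<psi> (fst z)))
        - f (v (snd z + 0) (\<psi> (fst z))) \<in> {0<..}})"
      by (rule openin_Int)
    also have "\<dots> = A"
      by (auto simp: A_def)
    finally have "openin ?Z A" .
    moreover have "(w0, 0) \<in> A"
      using w0 U N f x by (simp add: A_def flow_zero)
    ultimately obtain e where e: "e > 0" "\<And>z. \<lbrakk>z \<in> W \<times> UNIV; dist z (w0, 0) < e\<rbrakk> \<Longrightarrow> z \<in> A"
      unfolding openin_euclidean_subtopology_iff by meson
    show ?thesis
    proof
      fix w t assume w: "w \<in> W" "dist w w0 + \<bar>t\<bar> < e"
      have "dist (w, t) (w0, 0) \<le> dist w w0 + dist t 0"
        unfolding dist_Pair_Pair by (intro sqrt_sum_squares_le_sum) auto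
      then show "(w, t) \<in> A"
        using w by (intro e(2)) (auto simp: dist_real_def)
    qed (use e in auto)
  qed
  \<comment> \<open>With this choice \<open>\<rho> / 2 + 3 * \<eta> < \<rho>\<close>. Times up to
    \<open>3 * \<eta>\<close> are needed because a section point lies at a time below
    \<open>\<eta>\<close> from its chart point and is then moved for a time below
    \<open>2 * \<eta>\<close>.\<close>
  define \<eta> where "\<eta> = \<rho> / 8"
  have \<eta>: "\<eta> > 0"
    using \<rho> by (simp add: \<eta>_def)
  have F_mono: "F (v a (\<psi> w)) < F (v b (\<psi> w))"
    if w: "w \<in> W" "dist w w0 < \<rho> / 2" and ab: "-3 * \<eta> \<le> a" "a < b" "b \<le> 3 * \<eta>" for w a b
  proof -
    have "continuous_on UNIV (\<lambda>s. f (v s (\<psi> w)))"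
      using continuous_map_compose[OF continuous_map_time[OF \<psi>S[OF w(1)]] f(1)] by (simp add: o_def)
    moreover have "f (v s (\<psi> w)) < f (v (s + \<tau>') (\<psi> w))" if "a \<le> s" "s \<le> b" for s
      using \<rho>(2)[OF w(1), of s] w ab that \<rho>(1) by (auto simp: A_def \<eta>_def)
    ultimately have "integral {0..\<tau>'} (\<lambda>s. f (v (s + a) (\<psi> w))) < integral {0..\<tau>'} (\<lambda>s. f (v (s + b) (\<psi> w)))"
      using \<tau>'(1) ab by (intro moving_integral_strict_mono) auto
    then show ?thesis
      using w by (simp add: F_def flow_add \<psi>S)
  qed
  have F_slice: "continuous_on W (\<lambda>w. F (v a (\<psi> w)))" for a
  proof -
    have "continuous_on W (\<lambda>w. (\<lambda>(w, t). F (v t (\<psi> w))) (w, a))"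
      by (rule continuous_on_compose2[OF F_cont]) (auto intro!: continuous_intros)
    then show ?thesis
      by simp
  qed
  \<comment> \<open>Strict monotonicity at \<open>w0\<close> puts the level \<open>F x\<close>
    strictly between the values at times \<open>-\<eta>\<close> and \<open>\<eta>\<close>, and by
    continuity the same holds near \<open>w0\<close>.\<close>
  obtain r where r: "r > 0" "r \<le> \<rho> / 2"
    "\<And>w. \<lbrakk>w \<in> half_plane; dist w w0 < r\<rbrakk> \<Longrightarrow> w \<in> W \<and> F (v (-\<eta>) (\<psi> w)) < F x \<and> F x < F (v \<eta> (\<psi> w))"
  proof -
    have "openin (top_of_set W) (W \<inter> (\<lambda>w. F (v (-\<eta>) (\<psi> w))) -` {..<F x})"
      "openin (top_of_set W) (W \<inter> (\<lambda>w. F (v \<eta> (\<psi> w))) -` {F x<..})"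
      using F_slice by (auto intro!: continuous_openin_preimage_gen)
    then have "openin (top_of_set W) ((W \<inter> (\<lambda>w. F (v (-\<eta>) (\<psi> w))) -` {..<F x}) \<inter>
        (W \<inter> (\<lambda>w. F (v \<eta> (\<psi> w))) -` {F x<..}))" (is "openin _ ?R")
      by (rule openin_Int)
    then have "openin (top_of_set half_plane) ?R"
      using W openin_trans by blast
    moreover have "w0 \<in> ?R"
      using F_mono[of w0 "-\<eta>" 0] F_mono[of w0 0 \<eta>] w0 \<eta> \<rho> x by (simp add: flow_zero)
    ultimately obtain e where e: "e > 0" "\<And>z. \<lbrakk>z \<in> half_plane; dist z w0 < e\<rbrakk> \<Longrightarrow> z \<in> ?R"
      unfolding openin_euclidean_subtopology_iff by meson
    show ?thesis
    proof
      show "min e (\<rho> / 2) > 0" "min e (\<rho> / 2) \<le> \<rho> / 2"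
        using e \<rho> by auto
    qed (use e(2) in auto)
  qed
  define B where "B = half_plane \<inter> ball w0 r"
  have BW: "B \<subseteq> W" and Bd: "\<And>w. w \<in> B \<Longrightarrow> dist w w0 < \<rho> / 2"
    using r by (auto simp: B_def dist_commute)
  have w0B: "w0 \<in> B"
    using w0 WH r by (auto simp: B_def)
  obtain t where t: "continuous_on B t" "\<And>w. w \<in> B \<Longrightarrow> \<bar>t w\<bar> < \<eta> \<and> F (v (t w) (\<psi> w)) = F x"
  proof (rule strict_mono_level_function[of B "\<lambda>w t. F (v t (\<psi> w))" \<eta> "F x"])
    show "continuous_on (B \<times> UNIV) (\<lambda>(w, t). F (v t (\<psi> w)))"
      using F_cont BW by (auto intro: continuous_on_subset)
  qed (use F_mono BW Bd \<eta> r(3) in \<open>auto simp: B_def dist_commute\<close>)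
  have near: "v s (\<psi> w) \<in> U \<inter> N" if "w \<in> B" "\<bar>s\<bar> < 3 * \<eta>" for w s
    using \<rho>(2)[of w s] that BW Bd[of w] by (auto simp: A_def \<eta>_def)
  \<comment> \<open>\<open>q\<close> slides chart points along their orbits onto the level set of
    \<open>F\<close> through \<open>x\<close>. The section thus becomes a continuous image of the
    convex set \<open>B\<close>, hence path connected, with nothing known about the shape of the
    level set.\<close>
  define q where "q w = \<phi> (v (t w) (\<psi> w))" for w
  have qW: "q w \<in> W" and \<psi>q: "\<psi> (q w) = v (t w) (\<psi> w)" if "w \<in> B" for w
    using near[OF that, of "t w"] t(2)[OF that] \<eta> \<phi>W \<psi>\<phi> by (auto simp: q_def)
  have c\<psi>B: "continuous_map (top_of_set B) X \<psi>"
    using c\<psi> BW by (metis continuous_map_from_subtopology_mono)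
  have cq: "continuous_on B q"
  proof -
    have "continuous_map (top_of_set B) X (\<lambda>w. v (t w) (\<psi> w))"
      using t(1) c\<psi>B by (intro continuous_map_flow_comp) auto
    moreover have "(\<lambda>w. v (t w) (\<psi> w)) \<in> B \<rightarrow> U"
      using near t(2) \<eta> by fastforce
    ultimately have "continuous_map (top_of_set B) (subtopology X U) (\<lambda>w. v (t w) (\<psi> w))"
      by (simp add: continuous_map_in_subtopology)
    from continuous_map_compose[OF this c\<phi>] show ?thesis
      by (simp add: o_def q_def[abs_def] continuous_map_in_subtopology)
  qed
  define Q where "Q = q ` B"
  have QW: "Q \<subseteq> W"
    using qW by (auto simp: Q_def)
  have "convex B"
  proof -
    have "half_plane = {p. inner (0, 1) p \<ge> 0}"
      by (auto simp: half_plane_def)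
    then have "convex half_plane"
      by (metis convex_halfspace_ge)
    then show ?thesis
      unfolding B_def by (simp add: convex_Int)
  qed
  then have pcQ: "path_connected Q"
    unfolding Q_def by (intro path_connected_continuous_image cq convex_imp_path_connected)
  have sec: "s = 0 \<and> p = p'"
    if pp': "p \<in> Q" "p' \<in> Q" and s: "\<bar>s\<bar> < 2 * \<eta>" "v s (\<psi> p) = \<psi> p'" for p p' s
  proof -
    obtain w w' where w: "w \<in> B" "w' \<in> B" "p = q w" "p' = q w'"
      using pp' by (auto simp: Q_def)
    have "v (s + t w) (\<psi> w) = \<psi> p'"
      using s w \<psi>q \<psi>S BW by (metis flow_add subsetD)
    then have eq: "F (v (s + t w) (\<psi> w)) = F (v (t w) (\<psi> w))"
      using w t(2) \<psi>q by auto
    \<comment> \<open>Both points have the same value of \<open>F\<close>, and the times involved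
      stay in the window on which \<open>F\<close> is strictly monotone along the orbit.\<close>
    have "s = 0"
    proof (rule ccontr)
      assume "s \<noteq> 0"
      then consider "s + t w < t w" | "t w < s + t w"
        by linarith
      then show False
        using F_mono[of w "s + t w" "t w"] F_mono[of w "t w" "s + t w"] eq w BW Bd t(2)[of w] s \<eta>
        by cases (auto simp: abs_if split: if_splits)
    qed
    moreover have "\<psi> p = \<psi> p'"
      using s \<open>s = 0\<close> \<psi>S QW pp' by (metis flow_zero subsetD)
    ultimately show ?thesis
      using \<phi>\<psi> QW pp' by (metis subsetD)
  qed
  \<comment> \<open>A countable connected \<open>Q\<close> is a single point, so all of
    \<open>B\<close> lies on one orbit segment and \<open>t\<close> determines the chart point. Then
    \<open>t\<close> maps an open set of the plane injectively and continuously into the line,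
    against invariance of dimension.\<close>
  have unc: "uncountable Q"
  proof
    assume "countable Q"
    moreover have "connected Q"
      using pcQ path_connected_imp_connected by blast
    ultimately have Q1: "a = b" if "a \<in> Q" "b \<in> Q" for a b
      using connected_uncountable[of Q a b] that by blast
    \<comment> \<open>Boundary points of the half-plane are removed to get a set that is open in the
      plane.\<close>
    define B' where "B' = {p. snd p > 0} \<inter> ball w0 r"
    have "B' \<subseteq> B"
      by (auto simp: B'_def B_def half_plane_def)
    have "open B'"
      unfolding B'_def by (intro open_Int open_Collect_less continuous_intros open_ball)
    moreover have "w0 + (0, r / 2) \<in> B'"
      using w0 WH r by (auto simp: B'_def half_plane_def dist_norm norm_Pair)
    moreover have "inj_on t B'"
    proof (rule inj_onI)
      fix w w' assume w: "w \<in> B'" "w' \<in> B'" "t w = t w'"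
      then have wB: "w \<in> B" "w' \<in> B"
        using \<open>B' \<subseteq> B\<close> by auto
      have "q w = q w'"
        using Q1 wB by (auto simp: Q_def)
      then have "v (t w) (\<psi> w) = v (t w) (\<psi> w')"
        using \<psi>q wB w(3) by metis
      then have "\<psi> w = \<psi> w'"
        using flow_inject \<psi>S wB BW by blast
      then show "w = w'"
        using \<phi>\<psi> wB BW by (metis subsetD)
    qed
    moreover have "continuous_on B' t"
      using t(1) \<open>B' \<subseteq> B\<close> by (rule continuous_on_subset)
    ultimately have "DIM(real \<times> real) \<le> DIM(real)"
      using invariance_of_dimension[of B' t] by blast
    then show False
      by simp
  qed
  define M where "M = {y \<in> topspace (subtopology X U). \<phi> y \<in> B}"
  have "openin (subtopology X U) M"
  proof -
    have "B = W \<inter> ball w0 r"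
      using WH BW by (auto simp: B_def)
    then have "openin (top_of_set W) B"
      using openin_open by blast
    then show ?thesis
      unfolding M_def using c\<phi> openin_continuous_map_preimage by blast
  qed
  then have M: "openin X M"
    using U openin_trans_full by blast
  have xM: "x \<in> M"
    using x U w0B by (auto simp: M_def w0_def)
  have hit: "\<exists>s. \<bar>s\<bar> < \<eta> \<and> v s y \<in> \<psi> ` Q" if "y \<in> M" for y
  proof -
    have "\<phi> y \<in> B" "\<psi> (\<phi> y) = y"
      using that \<psi>\<phi> by (auto simp: M_def)
    then show ?thesis
      using \<psi>q[of "\<phi> y"] t(2)[of "\<phi> y"] by (metis Q_def imageI)
  qed
  have box: "openin X {v s (\<psi> (g u)) |s u. \<bar>s\<bar> < \<eta> \<and> 0 < u \<and> u < 1}"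
    if g: "arc g" "path_image g \<subseteq> Q" for g
  proof -
    define D where "D = {-\<eta><..<\<eta>} \<times> {0<..<1::real}"
    define e where "e = (\<lambda>(s, u). v s (\<psi> (g u)))"
    have gQ: "g u \<in> Q" if "0 < u" "u < 1" for u
      using that g by (auto simp: path_image_def)
    \<comment> \<open>The time from the chart point to the section and the time along the box are
      both below \<open>\<eta>\<close>, so the swept set stays in the chart.\<close>
    have eU: "e z \<in> U" if z: "z \<in> D" for z
    proof -
      obtain s u where su: "z = (s, u)" "\<bar>s\<bar> < \<eta>" "0 < u" "u < 1"
        using z by (auto simp: D_def)
      obtain w where w: "w \<in> B" "g u = q w"
        using gQ[of u] su by (auto simp: Q_def)
      have "\<psi> w \<in> topspace X"
        using w BW \<psi>S by blast
      then have "e z = v (s + t w) (\<psi> w)"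
        using su w \<psi>q by (simp add: e_def flow_add)
      then show ?thesis
        using near[OF w(1), of "s + t w"] t(2)[OF w(1)] su by auto
    qed
    have "continuous_map (top_of_set D) X e"
      unfolding e_def case_prod_beta
    proof (rule continuous_map_flow_comp)
      show "continuous_map (top_of_set D) euclideanreal fst"
        by (auto intro!: continuous_intros)
      have "continuous_on {0..1} g"
        using g arc_imp_path path_def by blast
      then have "continuous_on D (\<lambda>z. g (snd z))"
        by (rule continuous_on_compose2) (auto simp: D_def intro!: continuous_intros)
      moreover have "(\<lambda>z. g (snd z)) \<in> D \<rightarrow> W"
        using gQ QW by (auto simp: D_def)
      ultimately have "continuous_map (top_of_set D) (top_of_set W) (\<lambda>z. g (snd z))"
        by (simp add: continuous_map_in_subtopology)
      from continuous_map_compose[OF this c\<psi>]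
      show "continuous_map (top_of_set D) X (\<lambda>z. \<psi> (g (snd z)))"
        by (simp add: o_def)
    qed
    then have "continuous_map (top_of_set D) (subtopology X U) e"
      using eU by (auto simp: continuous_map_in_subtopology)
    from continuous_map_compose[OF this c\<phi>] have "continuous_on D (\<lambda>z. \<phi> (e z))"
      by (simp add: o_def continuous_map_in_subtopology)
    moreover have "inj_on (\<lambda>z. \<phi> (e z)) D"
    proof (rule inj_onI)
      fix z z' assume z: "z \<in> D" "z' \<in> D" "\<phi> (e z) = \<phi> (e z')"
      obtain s u s' u' where su: "z = (s, u)" "z' = (s', u')" "\<bar>s\<bar> < \<eta>" "0 < u" "u < 1"
        "\<bar>s'\<bar> < \<eta>" "0 < u'" "u' < 1"
        using z by (auto simp: D_def)
      have gS: "\<psi> (g u) \<in> topspace X" "\<psi> (g u') \<in> topspace X"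
        using gQ su QW \<psi>S by blast+
      have "e z = e z'"
        using z eU \<psi>\<phi> by metis
      then have "v (-s') (v s (\<psi> (g u))) = \<psi> (g u')"
        using su gS by (simp add: e_def flow_inverse)
      then have "v (s - s') (\<psi> (g u)) = \<psi> (g u')"
        using gS by (simp add: flow_add)
      then have "s - s' = 0 \<and> g u = g u'"
        using su gQ by (intro sec) auto
      moreover have "inj_on g {0..1}"
        using g arc_def by blast
      ultimately show "z = z'"
        using su by (auto dest!: inj_onD[of g _ u u'])
    qed
    moreover have "open D"
      by (simp add: D_def open_Times)
    ultimately have "open ((\<lambda>z. \<phi> (e z)) ` D)"
      by (intro invariance_of_domain)
    moreover have "(\<lambda>z. \<phi> (e z)) ` D \<subseteq> W"
      using eU \<phi>W by auto
    ultimately have "openin (top_of_set W) ((\<lambda>z. \<phi> (e z)) ` D)"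
      by (simp add: open_openin_trans openin_open_eq open_subset)
    then have "openin (subtopology X U) {y \<in> topspace (subtopology X U). \<phi> y \<in> (\<lambda>z. \<phi> (e z)) ` D}"
      using c\<phi> openin_continuous_map_preimage by blast
    also have "{y \<in> topspace (subtopology X U). \<phi> y \<in> (\<lambda>z. \<phi> (e z)) ` D} = e ` D"
      unfolding topU using eU \<psi>\<phi> by (auto simp: image_iff) metis+
    also have "e ` D = {v s (\<psi> (g u)) |s u. \<bar>s\<bar> < \<eta> \<and> 0 < u \<and> u < 1}"
      by (force simp: e_def D_def)
    finally show ?thesis
      using U openin_trans_full by blast
  qed
  have c\<psi>Q: "continuous_map (top_of_set Q) X \<psi>"
    using c\<psi> QW by (metis continuous_map_from_subtopology_mono)
  have \<psi>QN: "\<psi> ` Q \<subseteq> N"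
    using \<psi>q near t(2) \<eta> by (fastforce simp: Q_def)
  show thesis
  proof (rule that[OF _ \<psi>QN M xM hit])
    show "cross_section \<eta> Q \<psi>"
      unfolding cross_section_def
    proof (intro conjI[OF \<eta>] conjI[OF pcQ] conjI[OF unc] conjI[OF c\<psi>Q] conjI ballI allI impI)
      fix p p' s assume "p \<in> Q" "p' \<in> Q" "\<bar>s\<bar> < 2 * \<eta> \<and> v s (\<psi> p) = \<psi> p'"
      then have "s = 0 \<and> p = p'"
        using sec by metis
      then show "s = 0" "p = p'"
        by auto
    qed (simp add: box)
  qed
qed

section \<open>Orbits and the orbit space\<close>

lemma orbit_self: "x \<in> topspace X \<Longrightarrow> x \<in> orbit v x"
  unfolding orbit_def by (metis flow_zero rangeI)

lemma orbit_subset_topspace: "x \<in> topspace X \<Longrightarrow> orbit v x \<subseteq> topspace X"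
  by (auto simp: orbit_def flow_in_topspace)

lemma orbit_eq:
  assumes "x \<in> topspace X" "y \<in> orbit v x"
  shows "orbit v y = orbit v x"
proof -
  obtain s where s: "y = v s x"
    using assms by (auto simp: orbit_def)
  have "v t x = v (t - s) y" "v t y = v (t + s) x" for t
    using assms by (simp_all add: s flow_add)
  then show ?thesis
    unfolding orbit_def by (metis (no_types, lifting) image_subset_iff rangeI subset_antisym)
qed

lemma topspace_orbit_space: "topspace (orbit_space X v) = orbit v ` topspace X"
proof -
  have "{x \<in> topspace X. orbit v x \<in> orbit v ` topspace X} = topspace X"
    by auto
  then have "openin (orbit_space X v) (orbit v ` topspace X)"
    unfolding orbit_space_def openin_quotient_topology by simp
  moreover have "U \<subseteq> orbit v ` topspace X" if "openin (orbit_space X v) U" for U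
    using that unfolding orbit_space_def openin_quotient_topology by blast
  ultimately show ?thesis
    using openin_subset openin_topspace by (metis subset_antisym)
qed

lemma orbit_fibre: "x \<in> topspace X \<Longrightarrow> {y \<in> topspace X. orbit v y = orbit v x} = orbit v x"
  using orbit_self orbit_eq orbit_subset_topspace by blast

lemma openin_orbit_space_singleton:
  "x \<in> topspace X \<Longrightarrow> openin (orbit_space X v) {orbit v x} \<longleftrightarrow> openin X (orbit v x)"
  unfolding orbit_space_def openin_quotient_topology by (simp add: orbit_fibre)

lemma closedin_orbit_space_singleton:
  assumes x: "x \<in> topspace X"
  shows "closedin (orbit_space X v) {orbit v x} \<longleftrightarrow> closedin X (orbit v x)"
proof -
  have "{y \<in> topspace X. orbit v y \<in> orbit v ` topspace X - {orbit v x}}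
      = topspace X - {y \<in> topspace X. orbit v y = orbit v x}"
    by auto
  then have "openin (orbit_space X v) (orbit v ` topspace X - {orbit v x})
      \<longleftrightarrow> openin X (topspace X - orbit v x)"
    unfolding orbit_space_def openin_quotient_topology by (simp add: orbit_fibre[OF x])
  then show ?thesis
    using x orbit_subset_topspace by (simp add: closedin_def topspace_orbit_space)
qed

text \<open>A fixed point would be isolated. Otherwise an open orbit would contain a whole
  cross-section, which is uncountable, whereas the times at which one orbit meets a section are
  separated and hence countable.\<close>

lemma orbit_not_open:
  assumes "surface X" "compact_space X" and x: "x \<in> topspace X"
  shows "\<not> openin X (orbit v x)"
proof
  assume ope: "openin X (orbit v x)"
  show False
  proof (cases "\<exists>\<tau>. v \<tau> x \<noteq> x")
    case False
    then have "orbit v x = {x}"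
      by (auto simp: orbit_def)
    then show False
      using ope surface_not_openin_singleton[OF \<open>surface X\<close>] by auto
  next
    case True
    then obtain \<tau> where moved: "v \<tau> x \<noteq> x"
      by blast
    obtain \<eta> Q \<sigma> where cs: "cross_section \<eta> Q \<sigma>" and \<sigma>: "\<sigma> ` Q \<subseteq> orbit v x"
      using local_section[OF assms moved ope orbit_self[OF x]] by metis
    note \<eta> = cross_sectionD(1)[OF cs] and unc = cross_sectionD(3)[OF cs] and sec = cross_sectionD(5)[OF cs]
    have "\<forall>p\<in>Q. \<exists>t. \<sigma> p = v t x"
      using \<sigma> by (auto simp: orbit_def)
    then obtain T where T: "\<And>p. p \<in> Q \<Longrightarrow> \<sigma> p = v (T p) x"
      by metis
    \<comment> \<open>Times in the same cell of length \<open>\<eta>\<close> are too close to belong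
      to two different section points.\<close>
    have "inj_on (\<lambda>p. \<lfloor>T p / \<eta>\<rfloor>) Q"
    proof (rule inj_onI)
      fix p q assume pq: "p \<in> Q" "q \<in> Q" "\<lfloor>T p / \<eta>\<rfloor> = \<lfloor>T q / \<eta>\<rfloor>"
      then have "\<bar>T q / \<eta> - T p / \<eta>\<bar> < 1"
        by linarith
      then have "\<bar>T q - T p\<bar> < \<eta>"
        using \<eta> by (simp add: diff_divide_distrib[symmetric])
      then have "\<bar>T q - T p\<bar> < 2 * \<eta>"
        using \<eta> by linarith
      moreover have "v (T q - T p) (\<sigma> p) = \<sigma> q"
        using x by (simp only: T[OF pq(1)] T[OF pq(2)] flow_add) simp
      ultimately show "p = q"
        using sec[OF pq(1,2)] by blast
    qed
    then have "countable Q"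
      by (rule countableI')
    with unc show False
      by blast
  qed
qed

text \<open>Compactness makes the nested closures of the forward tails meet in some
  \<open>y\<close>. As the orbit is closed, \<open>y = v s x\<close>, and flowing back by
  \<open>s\<close> carries the recurrence from \<open>y\<close> to \<open>x\<close>.\<close>

lemma closed_orbit_imp_omega:
  assumes "compact_space X" and x: "x \<in> topspace X" and clo: "closedin X (orbit v x)"
  shows "x \<in> omega_limit X v x"
proof -
  define C where "C r = X closure_of {v t x |t. t > r}" for r
  have sub: "{v t x |t. t > r} \<subseteq> topspace X" for r
    using x flow_in_topspace by auto
  have C_mono: "C r \<subseteq> C s" if "s \<le> r" for r s
    unfolding C_def using that by (intro closure_of_mono) force
  have "(\<Inter>n::nat. C (real n)) \<noteq> {}"
  proof (rule compact_space_imp_nest[OF \<open>compact_space X\<close>])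
    show "closedin X (C (real n))" for n
      by (simp add: C_def)
    show "C (real n) \<noteq> {}" for n
    proof -
      have "v (real n + 1) x \<in> {v t x |t. t > real n}"
        by force
      then show ?thesis
        unfolding C_def using closure_of_subset[OF sub[of "real n"]] by blast
    qed
    show "decseq (\<lambda>n. C (real n))"
      by (simp add: decseq_def C_mono)
  qed
  then obtain y where y: "\<And>n::nat. y \<in> C (real n)"
    by auto
  have yC: "y \<in> C r" for r
    using y C_mono real_arch_simple[of r] by (meson subsetD)
  have "C 0 \<subseteq> orbit v x"
    unfolding C_def using clo by (intro closure_of_minimal) (auto simp: orbit_def)
  then obtain s where s: "y = v s x"
    using yC by (auto simp: orbit_def)
  have "x \<in> C r" for r
    unfolding C_def in_closure_of
  proof (intro conjI allI impI x)
    fix T assume T: "x \<in> T \<and> openin X T"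
    \<comment> \<open>Flowing back costs the time \<open>s\<close>, so visits to \<open>T'\<close>
      are sought after time \<open>r + s\<close>.\<close>
    define T' where "T' = {z \<in> topspace X. v (-s) z \<in> T}"
    have "openin X T'"
      unfolding T'_def using T continuous_map_flow openin_continuous_map_preimage by blast
    moreover have "y \<in> T'"
      using x T by (simp add: T'_def s flow_in_topspace flow_inverse)
    ultimately obtain t where t: "t > r + s" "v t x \<in> T'"
      using yC[of "r + s"] unfolding C_def in_closure_of by blast
    then have "v (t - s) x \<in> T"
      using x by (simp add: T'_def flow_add)
    then show "\<exists>y. y \<in> {v t x |t. t > r} \<and> y \<in> T"
      using t by (intro exI[of _ "v (t - s) x"]) (auto intro!: exI[of _ "t - s"])
  qed
  then show ?thesis
    by (simp add: omega_limit_def C_def)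
qed

lemma closed_orbit_imp_alpha:
  assumes "compact_space X" and x: "x \<in> topspace X" and clo: "closedin X (orbit v x)"
  shows "x \<in> alpha_limit X v x"
proof -
  \<comment> \<open>Time reversal exchanges the two limit sets and preserves orbits, so the forward
    result applies to the reversed flow.\<close>
  interpret rev: flow_on X "\<lambda>t. v (-t)"
  proof
    have "continuous_map (prod_topology euclideanreal X) X (\<lambda>z. v (- fst z) (snd z))"
      by (rule continuous_map_flow_comp)
        (auto intro!: continuous_intros continuous_map_fst continuous_map_snd)
    then show "flow X (\<lambda>t. v (-t))"
      by (simp add: flow_def case_prod_unfold flow_zero flow_add)
  qed
  have "range (\<lambda>t. v (-t) x) = (\<lambda>t. v t x) ` range uminus"
    by (simp only: image_image)
  then have "orbit (\<lambda>t. v (-t)) x = orbit v x"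
    by (simp add: orbit_def)
  then have "x \<in> omega_limit X (\<lambda>t. v (-t)) x"
    using rev.closed_orbit_imp_omega assms by simp
  then have "x \<in> X closure_of {v (-t) x |t. t > -n}" for n
    by (simp add: omega_limit_def)
  moreover have "{v (-t) x |t. t > -n} = {v t x |t. t < n}" for n
  proof -
    have "P t \<longleftrightarrow> P (- (-t))" "-t > -n \<longleftrightarrow> t < n" for P and t :: real
      by simp_all
    then show ?thesis
      by (smt (verit) Collect_cong)
  qed
  ultimately show ?thesis
    by (simp add: alpha_limit_def)
qed

text \<open>The orbit is the image of one compact period. Fixed points are included, since any
  nonzero \<open>T\<close> serves for them.\<close>

lemma periodic_imp_closed_orbit:
  assumes "Hausdorff_space X" and x: "x \<in> topspace X" and "v T x = x" "T \<noteq> 0"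
  shows "closedin X (orbit v x)"
proof -
  have "v (-T) x = x"
    using flow_inverse[OF x, of T] assms by simp
  then obtain P where P: "P > 0" "v P x = x"
    using assms by (cases "T > 0") (auto intro: that[of T] that[of "-T"])
  have nat: "v (real n * P) x = x" for n
  proof (induction n)
    case (Suc n)
    then show ?case
      using P x flow_add[of x P "real n * P"] by (simp add: algebra_simps)
  qed (simp add: x flow_zero)
  have int: "v (of_int k * P) x = x" for k
  proof (cases "k \<ge> 0")
    case True
    then show ?thesis
      using nat[of "nat k"] by simp
  next
    case False
    then show ?thesis
      using nat[of "nat (-k)"] flow_inverse[OF x, of "real (nat (-k)) * P"] by simp
  qed
  have "v t x \<in> (\<lambda>t. v t x) ` {0..P}" for t
  proof (rule image_eqI)
    show "v t x = v (t - of_int \<lfloor>t / P\<rfloor> * P) x"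
      using int[of "\<lfloor>t / P\<rfloor>"] x flow_add[of x "t - of_int \<lfloor>t / P\<rfloor> * P" "of_int \<lfloor>t / P\<rfloor> * P"] by simp
    show "t - of_int \<lfloor>t / P\<rfloor> * P \<in> {0..P}"
      using P floor_divide_lower[of P t] floor_divide_upper[of P t] by (auto simp: algebra_simps)
  qed
  then have "orbit v x = (\<lambda>t. v t x) ` {0..P}"
    by (auto simp: orbit_def)
  moreover have "compactin X ((\<lambda>t. v t x) ` {0..P})"
    using continuous_map_time[OF x] by (rule image_compactin[rotated]) simp
  ultimately show ?thesis
    using \<open>Hausdorff_space X\<close> compactin_imp_closedin by auto
qed

section \<open>Poisson stable flows\<close>

lemma poisson_stable_forward:
  assumes "poisson_stable_flow X v" "openin X G" "z \<in> G"
  obtains t where "t > r" "v t z \<in> G"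
proof -
  have "z \<in> X closure_of {v t z |t. t > r}"
    using assms openin_subset by (fastforce simp: poisson_stable_flow_def omega_limit_def)
  then show ?thesis
    using assms that unfolding in_closure_of by blast
qed

lemma poisson_stable_backward:
  assumes "poisson_stable_flow X v" "openin X G" "z \<in> G"
  obtains t where "t < r" "v t z \<in> G"
proof -
  have "z \<in> X closure_of {v t z |t. t < r}"
    using assms openin_subset by (fastforce simp: poisson_stable_flow_def alpha_limit_def)
  then show ?thesis
    using assms that unfolding in_closure_of by blast
qed

text \<open>By recurrence and compactness the return times to C are bounded, so the saturation of C is
  already swept out in bounded time.\<close>
lemma saturation_closed:
  assumes haus: "Hausdorff_space X" and ps: "poisson_stable_flow X v"
    and C: "compactin X C" and G: "openin X G" and "\<eta> > 0"
    and GC: "\<And>y. y \<in> G \<Longrightarrow> \<exists>s. \<bar>s\<bar> < \<eta> \<and> v s y \<in> C"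
    and CG: "\<And>c. c \<in> C \<Longrightarrow> \<exists>t. v t c \<in> G"
  shows "closedin X {y \<in> topspace X. \<exists>t. v t y \<in> G}"
proof -
  define V where "V = {y \<in> topspace X. \<exists>t. v t y \<in> G}"
  define R where "R t = {y \<in> topspace X. v t y \<in> G}" for t
  have CS: "C \<subseteq> topspace X"
    using C compactin_subset_topspace by blast
  \<comment> \<open>Moving from \<open>G\<close> to \<open>C\<close> changes the time by less than
    \<open>\<eta>\<close>; the bound \<open>1 + \<eta>\<close> leaves return times of at least
    1.\<close>
  have "\<exists>t\<in>{1 + \<eta><..}. c \<in> R t" if c: "c \<in> C" for c
  proof -
    obtain t where t: "v t c \<in> G"
      using CG c by blast
    obtain s where "s > 1 + \<eta> - t" "v s (v t c) \<in> G"
      using poisson_stable_forward[OF ps G t] by blast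
    then show ?thesis
      using c CS by (intro bexI[of _ "s + t"]) (auto simp: R_def flow_add)
  qed
  then have "C \<subseteq> \<Union> (R ` {1 + \<eta><..})"
    by blast
  moreover have "openin X (R t)" for t
    unfolding R_def using G continuous_map_flow openin_continuous_map_preimage by blast
  ultimately obtain \<F> where "finite \<F>" "\<F> \<subseteq> R ` {1 + \<eta><..}" "C \<subseteq> \<Union>\<F>"
    using compactinD[OF C, of "R ` {1 + \<eta><..}"] by blast
  then obtain D where D: "D \<subseteq> {1 + \<eta><..}" "finite D" "C \<subseteq> \<Union> (R ` D)"
    using finite_subset_image by metis
  obtain m where m: "\<And>t. t \<in> D \<Longrightarrow> t \<le> m"
    using bdd_above_finite[OF D(2)] by (auto simp: bdd_above_def)
  \<comment> \<open>The maximum ensures \<open>0 \<le> L\<close> without asking whether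
    \<open>D\<close> is empty.\<close>
  define L where "L = max 0 (m + \<eta>)"
  have return: "\<exists>t. 1 \<le> t \<and> t \<le> L \<and> v t c \<in> C" if c: "c \<in> C" for c
  proof -
    obtain t where t: "t \<in> D" "v t c \<in> G"
      using D(3) c by (auto simp: R_def)
    obtain s where s: "\<bar>s\<bar> < \<eta>" "v s (v t c) \<in> C"
      using GC t by blast
    then show ?thesis
      using D(1) m[OF t(1)] t c CS
      by (intro exI[of _ "s + t"]) (auto simp: L_def flow_add subset_iff)
  qed
  define E where "E = (\<lambda>(t, x). v t x) ` ({0..L} \<times> C)"
  \<comment> \<open>While \<open>\<tau>\<close> exceeds \<open>L\<close>, a return to
    \<open>C\<close> uses up at least one unit of it, so the induction ends with a remaining time of
    at most \<open>L\<close>, counted from another point of \<open>C\<close>.\<close>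
  have inE: "v \<tau> c \<in> E" if "c \<in> C" "0 \<le> \<tau>" "\<tau> \<le> real n" for n \<tau> c
    using that
  proof (induction n arbitrary: \<tau> c)
    case 0
    then show ?case
      by (auto simp: E_def L_def intro!: image_eqI[of _ _ "(0, c)"])
  next
    case (Suc n)
    show ?case
    proof (cases "\<tau> \<le> L")
      case True
      then show ?thesis
        using Suc by (auto simp: E_def)
    next
      case False
      obtain t where t: "1 \<le> t" "t \<le> L" "v t c \<in> C"
        using return Suc by blast
      then have "v (\<tau> - t) (v t c) \<in> E"
        using False Suc by (intro Suc.IH) auto
      then show ?thesis
        using Suc CS by (simp add: flow_add subset_iff)
    qed
  qed
  have "V = E"
  proof
    show "V \<subseteq> E"
    proof
      fix y assume "y \<in> V"
      then obtain t where y: "y \<in> topspace X" and t: "v t y \<in> G"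
        by (auto simp: V_def)
      \<comment> \<open>Backward recurrence finds a point of \<open>C\<close> in the past of
        \<open>y\<close>, so forward times suffice for the saturation.\<close>
      obtain s where s: "s < -t - \<eta>" "v s (v t y) \<in> G"
        using poisson_stable_backward[OF ps G t] by blast
      then obtain s' where s': "\<bar>s'\<bar> < \<eta>" "v s' (v s (v t y)) \<in> C"
        using GC by blast
      define a where "a = s' + (s + t)"
      have a: "a < 0" "v a y \<in> C"
        using s s' y by (auto simp: a_def flow_add)
      obtain n :: nat where "- a \<le> real n"
        using real_arch_simple by blast
      then have "v (-a) (v a y) \<in> E"
        using a by (intro inE) auto
      then show "y \<in> E"
        using y by (simp add: flow_inverse)
    qed
    show "E \<subseteq> V"
    proof
      fix y assume "y \<in> E"
      then obtain t c where tc: "c \<in> C" "y = v t c"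
        by (auto simp: E_def)
      obtain s where "v s c \<in> G"
        using CG tc by blast
      then have "v (s - t) y \<in> G"
        using tc CS by (simp add: flow_add subset_iff)
      then show "y \<in> V"
        using tc CS flow_in_topspace by (auto simp: V_def)
    qed
  qed
  moreover have "compactin X E"
    unfolding E_def
  proof (rule image_compactin)
    show "compactin (prod_topology euclideanreal X) ({0..L} \<times> C)"
      using C by (simp add: compactin_Times)
    show "continuous_map (prod_topology euclideanreal X) X (\<lambda>(t, x). v t x)"
      using flow by (simp add: flow_def)
  qed
  ultimately show ?thesis
    using haus compactin_imp_closedin by (auto simp: V_def)
qed

text \<open>Two section points on the orbit of x are the endpoints of an arc in the section whose interior
  contains a third one. Hence the endpoints flow into the open set swept by the interior of the arc,
  and the saturation of that set is both open and closed.\<close>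
lemma nonperiodic_imp_orbits_meet:
  assumes "surface X" "compact_space X" "connected_space X" and ps: "poisson_stable_flow X v"
    and x: "x \<in> topspace X" and nonper: "\<And>t. v t x = x \<Longrightarrow> t = 0"
    and N: "openin X N" "x \<in> N" and z: "z \<in> topspace X"
  shows "\<exists>t. v t z \<in> N"
proof -
  have inj: "a = b" if "v a x = v b x" for a b
  proof -
    have "v (a - b) x = v (- b) (v a x)"
      using x by (simp add: flow_add)
    also have "\<dots> = x"
      using x that by (simp add: flow_inverse)
    finally show ?thesis
      using nonper by fastforce
  qed
  have moved: "v 1 x \<noteq> x"
    using nonper[of 1] by auto
  obtain \<eta> Q \<sigma> M where cs: "cross_section \<eta> Q \<sigma>" and \<sigma>N: "\<sigma> ` Q \<subseteq> N"
    and M: "openin X M" "x \<in> M" "\<And>y. y \<in> M \<Longrightarrow> \<exists>s. \<bar>s\<bar> < \<eta> \<and> v s y \<in> \<sigma> ` Q"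
    using local_section[OF assms(1,2) x moved N] by metis
  note \<eta> = cross_sectionD(1)[OF cs] and Q = cross_sectionD(2)[OF cs] and \<sigma> = cross_sectionD(4)[OF cs]
    and sec = cross_sectionD(5)[OF cs] and box = cross_sectionD(6)[OF cs]
  have \<sigma>S: "\<sigma> p \<in> topspace X" if "p \<in> Q" for p
    using \<sigma> that by (auto simp: continuous_map_def)
  have hit: "\<exists>p\<in>Q. \<exists>b. \<bar>b - t\<bar> < \<eta> \<and> \<sigma> p = v b x" if t: "v t x \<in> M" for t
  proof -
    obtain s p where "\<bar>s\<bar> < \<eta>" "p \<in> Q" "v s (v t x) = \<sigma> p"
      using M(3)[OF t] by (metis imageE)
    then show ?thesis
      using x by (intro bexI[of _ p] exI[of _ "s + t"]) (auto simp: flow_add)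
  qed
  \<comment> \<open>Gaps above \<open>2 * \<eta>\<close> survive the corrections below
    \<open>\<eta>\<close> that move the points onto the section. The three orbit times stay
    distinct, and so do the section points, as \<open>x\<close> is not periodic.\<close>
  obtain t2 where t2: "t2 > 2 * \<eta>" "v t2 x \<in> M"
    using poisson_stable_forward[OF ps M(1,2)] by blast
  obtain t3 where t3: "t3 > t2 + 2 * \<eta>" "v t3 x \<in> M"
    using poisson_stable_forward[OF ps M(1,2)] by blast
  obtain p1 b1 where p1: "p1 \<in> Q" "\<bar>b1 - 0\<bar> < \<eta>" "\<sigma> p1 = v b1 x"
    using hit[of 0] M x by (auto simp: flow_zero)
  obtain p2 b2 where p2: "p2 \<in> Q" "\<bar>b2 - t2\<bar> < \<eta>" "\<sigma> p2 = v b2 x"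
    using hit[OF t2(2)] by blast
  obtain p3 b3 where p3: "p3 \<in> Q" "\<bar>b3 - t3\<bar> < \<eta>" "\<sigma> p3 = v b3 x"
    using hit[OF t3(2)] by blast
  have "b1 < b2" "b2 < b3"
    using p1 p2 p3 t2 t3 by linarith+
  then have dist: "p1 \<noteq> p2" "p1 \<noteq> p3" "p2 \<noteq> p3"
    using inj p1 p2 p3 by force+
  have box_mem: "\<sigma> (g u) \<in> {v s (\<sigma> (g u)) |s u. \<bar>s\<bar> < \<eta> \<and> 0 < u \<and> u < 1}"
    if "path_image g \<subseteq> Q" "0 < u" "u < 1" for g u
  proof -
    have "g u \<in> Q"
      using that by (auto simp: path_image_def)
    then have "\<sigma> (g u) = v 0 (\<sigma> (g u))"
      using \<sigma>S by (simp add: flow_zero)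
    moreover have "\<bar>0\<bar> < \<eta>"
      using \<eta> by simp
    ultimately show ?thesis
      using that(2,3) by blast
  qed
  \<comment> \<open>This is the no-branching condition of \<open>arc_through_third_point\<close>: a
    section point in the open flow box has box time 0 by \<open>sec\<close>, so it lies on the open
    arc itself.\<close>
  have ope: "openin (top_of_set Q) (g ` {0<..<1})" if g: "arc g" "path_image g \<subseteq> Q" for g
  proof -
    let ?G = "{v s (\<sigma> (g u)) |s u. \<bar>s\<bar> < \<eta> \<and> 0 < u \<and> u < 1}"
    have gQ: "g u \<in> Q" if "0 < u" "u < 1" for u
      using that g by (auto simp: path_image_def)
    have "openin (top_of_set Q) {p \<in> topspace (top_of_set Q). \<sigma> p \<in> ?G}"
      using openin_continuous_map_preimage[OF \<sigma> box[OF g]] .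
    also have "{p \<in> topspace (top_of_set Q). \<sigma> p \<in> ?G} = g ` {0<..<1}"
    proof
      show "{p \<in> topspace (top_of_set Q). \<sigma> p \<in> ?G} \<subseteq> g ` {0<..<1}"
      proof
        fix p assume "p \<in> {p \<in> topspace (top_of_set Q). \<sigma> p \<in> ?G}"
        then obtain s u where su: "p \<in> Q" "\<sigma> p = v s (\<sigma> (g u))" "\<bar>s\<bar> < \<eta>" "0 < u" "u < 1"
          by auto
        then have "g u = p"
          using sec[of "g u" p s] gQ \<eta> by auto
        then show "p \<in> g ` {0<..<1}"
          using su by auto
      qed
      show "g ` {0<..<1} \<subseteq> {p \<in> topspace (top_of_set Q). \<sigma> p \<in> ?G}"
        using box_mem[OF g(2)] gQ by auto
    qed
    finally show ?thesis .
  qed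
  obtain g where g: "arc g" "path_image g \<subseteq> Q" "pathstart g \<in> {p1, p2, p3}"
    "pathfinish g \<in> {p1, p2, p3}" "g ` {0<..<1} \<inter> {p1, p2, p3} \<noteq> {}"
    using arc_through_third_point[OF Q ope p1(1) p2(1) p3(1) dist] by blast
  have orb: "\<exists>b. \<sigma> p = v b x" if "p \<in> {p1, p2, p3}" for p
    using that p1 p2 p3 by auto
  define G where "G = {v s (\<sigma> (g u)) |s u. \<bar>s\<bar> < \<eta> \<and> 0 < u \<and> u < 1}"
  define C where "C = \<sigma> ` path_image g"
  have G: "openin X G"
    unfolding G_def using box g by blast
  have gQ: "g u \<in> Q" if "0 \<le> u" "u \<le> 1" for u
    using that g by (auto simp: path_image_def)
  have intG: "\<sigma> (g u) \<in> G" if "0 < u" "u < 1" for u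
    unfolding G_def using box_mem[OF g(2) that] .
  have GC: "\<exists>s. \<bar>s\<bar> < \<eta> \<and> v s y \<in> \<sigma> ` path_image g" if y: "y \<in> G" for y
  proof -
    obtain s u where su: "y = v s (\<sigma> (g u))" "\<bar>s\<bar> < \<eta>" "0 < u" "u < 1"
      using y by (auto simp: G_def)
    then have "v (-s) y = \<sigma> (g u)"
      using gQ[of u] \<sigma>S by (simp add: flow_inverse)
    then show ?thesis
      using su by (intro exI[of _ "-s"]) (auto simp: path_image_def)
  qed
  have CG: "\<exists>t. v t c \<in> G" if c: "c \<in> C" for c
  proof -
    obtain u where u: "0 \<le> u" "u \<le> 1" "c = \<sigma> (g u)"
      using c by (auto simp: C_def path_image_def)
    show ?thesis
    proof (cases "0 < u \<and> u < 1")
      case True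
      then show ?thesis
        using intG u gQ \<sigma>S by (intro exI[of _ 0]) (auto simp: flow_zero)
    next
      case False
      then have "g u \<in> {p1, p2, p3}"
        using u g(3,4) by (cases "u = 0") (auto simp: pathstart_def pathfinish_def)
      then obtain a where a: "c = v a x"
        using orb u by blast
      obtain u' where "0 < u'" "u' < 1" "g u' \<in> {p1, p2, p3}"
        using g(5) by auto
      moreover from this obtain b where "\<sigma> (g u') = v b x"
        using orb by blast
      ultimately have "v (b - a) c \<in> G"
        using intG[of u'] a x by (simp add: flow_add)
      then show ?thesis
        by blast
    qed
  qed
  have "compactin X C"
  proof -
    have "compactin (top_of_set Q) (path_image g)"
      using g by (simp add: compactin_subtopology compact_path_image arc_imp_path)
    then show ?thesis
      unfolding C_def using \<sigma> by (rule image_compactin)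
  qed
  define V where "V = {y \<in> topspace X. \<exists>t. v t y \<in> G}"
  have "closedin X V"
    unfolding V_def
  proof (rule saturation_closed[OF _ ps \<open>compactin X C\<close> G \<eta>])
    show "Hausdorff_space X"
      using \<open>surface X\<close> by (simp add: surface_def)
  qed (use GC CG in \<open>auto simp: C_def\<close>)
  moreover have "openin X V"
  proof -
    have "openin X {y \<in> topspace X. v t y \<in> G}" for t
      using G continuous_map_flow openin_continuous_map_preimage by blast
    then have "openin X (\<Union>t. {y \<in> topspace X. v t y \<in> G})"
      by blast
    also have "(\<Union>t. {y \<in> topspace X. v t y \<in> G}) = V"
      by (auto simp: V_def)
    finally show ?thesis .
  qed
  moreover have "V \<noteq> {}"
  proof -
    have "\<sigma> (g 0) \<in> C" "\<sigma> (g 0) \<in> topspace X"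
      using gQ \<sigma>S by (auto simp: C_def path_image_def)
    then show ?thesis
      using CG by (auto simp: V_def)
  qed
  ultimately have "V = topspace X"
    using \<open>connected_space X\<close> unfolding connected_space_clopen_in by blast
  then obtain t where t: "v t z \<in> G"
    using z by (auto simp: V_def)
  then obtain s where "v s (v t z) \<in> \<sigma> ` path_image g"
    using GC by blast
  then have "v (s + t) z \<in> N"
    using g(2) \<sigma>N z by (auto simp: flow_add)
  then show ?thesis
    by blast
qed

text \<open>A nonperiodic point lies in every closed set that contains a full orbit. Applied to
  \<open>x\<close> this excludes periodic points; applied then to all points it shows that every
  nonempty closed invariant set is the whole space.\<close>

lemma nonperiodic_imp_minimal:
  assumes "surface X" "compact_space X" "connected_space X" and "poisson_stable_flow X v"
    and x: "x \<in> topspace X" and nonper: "\<And>t. v t x = x \<Longrightarrow> t = 0"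
  shows "minimal_flow X v"
proof -
  have haus: "Hausdorff_space X"
    using assms by (simp add: surface_def)
  \<comment> \<open>Otherwise the complement of \<open>A\<close> is a neighbourhood of
    \<open>y\<close> that the orbit of \<open>z\<close> has to enter.\<close>
  have adh: "y \<in> A" if A: "closedin X A" "\<And>t. v t z \<in> A" and z: "z \<in> topspace X"
    and y: "y \<in> topspace X" "\<And>t. v t y = y \<Longrightarrow> t = 0" for A z y
  proof (rule ccontr)
    assume "y \<notin> A"
    then obtain t where "v t z \<in> topspace X - A"
      using nonperiodic_imp_orbits_meet[OF assms(1-4) y, of "topspace X - A" z] A y z by auto
    then show False
      using A by blast
  qed
  \<comment> \<open>The closed orbit of a periodic \<open>z\<close> would contain \<open>x\<close>,
    and \<open>x\<close> would inherit its period.\<close>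
  have all: "t = 0" if z: "z \<in> topspace X" and t: "v t z = z" for z t
  proof (rule ccontr)
    assume "t \<noteq> 0"
    then have "closedin X (orbit v z)"
      using periodic_imp_closed_orbit[OF haus z t] by blast
    then have "x \<in> orbit v z"
      using adh[of "orbit v z" z x] z x nonper by (auto simp: orbit_def)
    then obtain s where s: "x = v s z"
      by (auto simp: orbit_def)
    have "v t x = v (t + s) z" "v s (v t z) = v (s + t) z"
      using z by (simp_all add: s flow_add)
    then have "v t x = x"
      using s t by (simp add: add.commute)
    then show False
      using nonper \<open>t \<noteq> 0\<close> by blast
  qed
  show ?thesis
    unfolding minimal_flow_def
  proof clarify
    fix A assume A: "closedin X A" "A \<noteq> {}" "A \<noteq> topspace X" "\<forall>t. \<forall>x\<in>A. v t x \<in> A"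
    then have AS: "A \<subseteq> topspace X"
      by (simp add: closedin_subset)
    obtain z where z: "z \<in> A"
      using A by blast
    have "y \<in> A" if "y \<in> topspace X" for y
      using adh[of A z y] A z AS that all by blast
    then show False
      using A(3) AS by blast
  qed
qed

end

section \<open>The equivalence of the three conditions\<close>

theorem theorem6p2:
  fixes X :: "'a topology" and v :: "real \<Rightarrow> 'a \<Rightarrow> 'a"
  assumes "surface X" and "topspace X \<noteq> {}" and "connected_space X" and "compact_space X" and "flow X v"
  shows "(t1_space (orbit_space X v) \<longleftrightarrow> t_half_space (orbit_space X v)) \<and>
         (t_half_space (orbit_space X v) \<longleftrightarrow>
            (\<not> minimal_flow X v \<and> poisson_stable_flow X v))"
proof -
  interpret flow_on X v
    by standard fact
  have haus: "Hausdorff_space X"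
    using assms by (simp add: surface_def)
  have t1: "t1_space (orbit_space X v) \<longleftrightarrow> (\<forall>x\<in>topspace X. closedin X (orbit v x))"
    by (simp add: t1_space_closedin_singleton topspace_orbit_space closedin_orbit_space_singleton)
  \<comment> \<open>The open alternative in the separation axiom never occurs, since no orbit is
    open.\<close>
  have half: "t_half_space (orbit_space X v) \<longleftrightarrow> (\<forall>x\<in>topspace X. closedin X (orbit v x))"
    using orbit_not_open assms
    by (simp add: t_half_space_def topspace_orbit_space closedin_orbit_space_singleton
        openin_orbit_space_singleton)
  have "\<not> minimal_flow X v \<and> poisson_stable_flow X v"
    if clo: "\<forall>x\<in>topspace X. closedin X (orbit v x)"
  proof
    obtain x where x: "x \<in> topspace X"
      using assms by blast
    have "v t y \<in> orbit v x" if "y \<in> orbit v x" for t y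
      using orbit_eq[OF x that] by (auto simp: orbit_def)
    \<comment> \<open>The whole space is open and no orbit is, so a closed orbit witnesses that the
      flow is not minimal.\<close>
    moreover have "orbit v x \<noteq> topspace X"
      using orbit_not_open[OF assms(1,4) x] by auto
    moreover have "orbit v x \<noteq> {}"
      using orbit_self[OF x] by blast
    ultimately show "\<not> minimal_flow X v"
      unfolding minimal_flow_def using clo x by blast
    show "poisson_stable_flow X v"
      unfolding poisson_stable_flow_def
      using clo closed_orbit_imp_omega closed_orbit_imp_alpha assms by blast
  qed
  moreover have "closedin X (orbit v x)"
    if "\<not> minimal_flow X v" "poisson_stable_flow X v" and x: "x \<in> topspace X" for x
  proof -
    have "\<exists>t. v t x = x \<and> t \<noteq> 0"
      using nonperiodic_imp_minimal[OF assms(1,4,3) that(2) x] that(1) by blast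
    then show ?thesis
      using periodic_imp_closed_orbit[OF haus x] by blast
  qed
  ultimately show ?thesis
    using t1 half by blast
qed

end
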